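(* For any fixed finite simple graph $L$ with at least one edge, $$DC(L,\mathrm{ind})=\frac{1}{\chi(L)-1},$$ where $\chi(L)$ denotes the chromatic number of $L$.
   Context: All graphs are finite and simple. For two graphs $G,G'$ on the vertex set $[n]=\{1,\dots,n\}$, $G\oplus G'$ denotes the graph on $[n]$ whose edge set is the symmetric difference of $E(G)$ and $E(G')$. For a fixed graph $L$, $M_{L,\mathrm{ind}}(n)$ denotes the maximum possible size of a family of (labeled) graphs on vertex set $[n]$ such that for any two distinct members $G,G'$ of the family, $G\oplus G'$ contains an induced subgraph isomorphic to $L$. Define $$DC(L,\mathrm{ind}):=\lim_{n\to\infty}\frac{2}{n(n-1)}\log_2 M_{L,\mathrm{ind}}(n),$$ where the limit is known to exist. *)

theory Defs
  imports Complex_Main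
begin

text \<open>A graph is a pair of a vertex set and a set of edges, an edge being a two-element set of
  vertices.\<close>

type_synonym 'a graph = "'a set \<times> 'a set set"

abbreviation verts :: "'a graph \<Rightarrow> 'a set" where
  "verts G \<equiv> fst G"

abbreviation edges :: "'a graph \<Rightarrow> 'a set set" where
  "edges G \<equiv> snd G"

definition all_edges :: "'a set \<Rightarrow> 'a set set" where
  "all_edges V = {e. e \<subseteq> V \<and> card e = 2}"

definition finite_simple_graph :: "'a graph \<Rightarrow> bool" where
  "finite_simple_graph G \<longleftrightarrow> finite (verts G) \<and> edges G \<subseteq> all_edges (verts G)"

definition proper_colouring :: "'a graph \<Rightarrow> nat \<Rightarrow> ('a \<Rightarrow> nat) \<Rightarrow> bool" where
  "proper_colouring G k c \<longleftrightarrow>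
     (\<forall>v\<in>verts G. c v < k) \<and>
     (\<forall>u\<in>verts G. \<forall>v\<in>verts G. {u, v} \<in> edges G \<longrightarrow> c u \<noteq> c v)"

definition chromatic_number :: "'a graph \<Rightarrow> nat" where
  "chromatic_number G = (LEAST k. \<exists>c. proper_colouring G k c)"

definition induced_subgraph :: "'a graph \<Rightarrow> 'a set \<Rightarrow> 'a graph" where
  "induced_subgraph G W = (W, {e \<in> edges G. e \<subseteq> W})"

definition graph_isomorphic :: "'a graph \<Rightarrow> 'b graph \<Rightarrow> bool" where
  "graph_isomorphic G H \<longleftrightarrow>
     (\<exists>f. bij_betw f (verts G) (verts H) \<and>
          (\<forall>u\<in>verts G. \<forall>v\<in>verts G. {u, v} \<in> edges G \<longleftrightarrow> {f u, f v} \<in> edges H))"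

definition contains_induced :: "'a graph \<Rightarrow> 'b graph \<Rightarrow> bool" where
  "contains_induced G L \<longleftrightarrow> (\<exists>W\<subseteq>verts G. graph_isomorphic (induced_subgraph G W) L)"

definition labelled_graphs :: "nat \<Rightarrow> nat graph set" where
  "labelled_graphs n = {G. verts G = {1..n} \<and> edges G \<subseteq> all_edges {1..n}}"

text \<open>Only applied to graphs with the same vertex set.\<close>

definition graph_sum :: "'a graph \<Rightarrow> 'a graph \<Rightarrow> 'a graph" where
  "graph_sum G G' = (verts G, sym_diff (edges G) (edges G'))"

definition ind_code :: "'b graph \<Rightarrow> nat \<Rightarrow> nat graph set \<Rightarrow> bool" where
  "ind_code L n F \<longleftrightarrow>
     F \<subseteq> labelled_graphs n \<and>
     (\<forall>G\<in>F. \<forall>G'\<in>F. G \<noteq> G' \<longrightarrow> contains_induced (graph_sum G G') L)"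

text \<open>The maximum is over a finite nonempty set, as there are finitely many labelled graphs and the
  empty family qualifies.\<close>

definition M_ind :: "'b graph \<Rightarrow> nat \<Rightarrow> nat" where
  "M_ind L n = Max {card F | F. ind_code L n F}"

definition ind_rate :: "'b graph \<Rightarrow> nat \<Rightarrow> real" where
  "ind_rate L n = 2 / (real n * (real n - 1)) * log 2 (real (M_ind L n))"

definition DC_ind :: "'b graph \<Rightarrow> real" where
  "DC_ind L = lim (ind_rate L)"

end

theory Submission
  imports Defs "HOL-Library.FuncSet" "HOL-Real_Asymp.Real_Asymp"
begin

text \<open>Write \<open>r\<close> for the chromatic number of \<open>L\<close>, so \<open>r \<ge> 2\<close>, and let the Turan graph with \<open>k\<close> classes
  on \<open>{1..n}\<close> be the graph joining the numbers that differ modulo \<open>k\<close>.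

  Upper bound: every subgraph of the Turan graph with \<open>r - 1\<close> classes is \<open>(r - 1)\<close>-colourable and so
  contains no copy of \<open>L\<close>. Hence two members of a code never agree on all the pairs outside that
  graph, and there are about \<open>n\<^sup>2 / (2 (r - 1))\<close> such pairs.

  Lower bound: take a large constant \<open>k\<close> and use only subgraphs of the Turan graph \<open>T\<close> with \<open>k\<close> classes,
  which costs a fraction of about \<open>1 / k\<close> of the pairs. A maximal code of such graphs has at least
  \<open>2\<^bsup>e(T)\<^esup> / b\<close> members, where \<open>b\<close> is the number of subgraphs of \<open>T\<close> with no induced copy of \<open>L\<close>
  (\<open>Gilbert_Varshamov\<close>). What remains is to bound \<open>b\<close> by
  \<open>2\<^bsup>(1 - 1 / (r - 1) + o(1)) n\<^sup>2 / 2\<^esup>\<close>. The restriction to \<open>T\<close> is essential: among all graphs there can be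
  far too many without an induced copy of \<open>L\<close> (split graphs, for \<open>L\<close> a 4-cycle), because
  a large vertex set may span a clique. Inside \<open>T\<close> each of the \<open>k\<close> classes is independent.

  The induced problem reduces to a non-induced one by shattering. A family of sets is at most as large
  as the family of sets it shatters (\<open>card_le_card_shattered\<close>). If the subgraphs of \<open>T\<close> without an induced \<open>L\<close> shattered an
  edge set containing a complete \<open>r\<close>-partite graph with large parts, one could shrink
  each part into a single class of \<open>T\<close>, place the colour classes of \<open>L\<close> in the parts and prescribe
  the edges between the parts as in \<open>L\<close>; there are no edges inside the parts, so this yields an induced
  copy of \<open>L\<close> (\<open>contains_induced_if_shatters\<close>). So \<open>b\<close> is at most the number of graphs without a complete
  \<open>r\<close>-partite subgraph with parts of some constant size.

  These graphs are counted, following the theorem of Erdos, Frankl and Roedl, by induction on the number of parts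
  (\<open>card_multipartite_free_le_powr\<close>), with no use of a regularity lemma. A graph free of the complete
  \<open>(r + 1)\<close>-partite graph with parts of size \<open>t\<close> is either free of the \<open>r\<close>-partite one with parts of a large
  size \<open>s\<close>, or has a copy of the latter on a set \<open>U\<close> of \<open>r s\<close> vertices. In the second case
  all but boundedly many other vertices have fewer than \<open>t\<close> neighbours in some part of \<open>U\<close>, so a vertex
  has only about \<open>2\<^bsup>(r - 1) s\<^esup>\<close> possible neighbourhoods in \<open>U\<close>. Deleting \<open>U\<close> and iterating
  gives \<open>(r - 1) / r\<close> free bits per pair of vertices.\<close>

section \<open>Shattered sets\<close>

definition shatters :: "'a set set \<Rightarrow> 'a set \<Rightarrow> bool" where
  "shatters F S \<longleftrightarrow> (\<forall>T\<subseteq>S. \<exists>X\<in>F. X \<inter> S = T)"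

text \<open>Pajor's form of the Sauer-Shelah lemma. Delete a point \<open>x\<close> of the ground set: \<open>F0\<close> is the
  trace of the family on the rest and \<open>F1\<close> consists of the traces that extend in both ways. A set shattered by \<open>F0\<close> is
  shattered by the family, and so is \<open>insert x S\<close> for each \<open>S\<close> shattered by \<open>F1\<close>.\<close>

lemma card_le_card_shattered:
  assumes "finite U" and "F \<subseteq> Pow U"
  shows "card F \<le> card {S. S \<subseteq> U \<and> shatters F S}"
  using assms
proof (induction U arbitrary: F rule: finite_induct)
  case empty
  moreover have "shatters F {}" if "F \<noteq> {}" using that by (auto simp: shatters_def)
  ultimately have "card F \<le> card {{} :: 'a set} \<and> (F \<noteq> {} \<longrightarrow> {{}} \<subseteq> {S. S \<subseteq> {} \<and> shatters F S})"
    using card_mono[of "{{}}" F] by auto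
  then show ?case using card_mono[of "{S. S \<subseteq> {} \<and> shatters F S}" "{{}}"]
    by (cases "F = {}") (auto intro: le_trans)
next
  case (insert x U)
  define F0 where "F0 = (\<lambda>X. X - {x}) ` F"
  define F1 where "F1 = {X \<in> Pow U. X \<in> F \<and> insert x X \<in> F}"
  let ?sh = "\<lambda>G. {S. S \<subseteq> U \<and> shatters G S}"
  have finF: "finite F"
    using insert.prems insert.hyps by (meson finite_Pow_iff finite_insert finite_subset)
  have F0: "F0 \<subseteq> Pow U" and F1: "F1 \<subseteq> Pow U"
    using insert.prems by (auto simp: F0_def F1_def)
  have fin: "finite F0" "finite F1" using F0 F1 insert.hyps by (meson finite_Pow_iff finite_subset)+
  have "card F \<le> card F0 + card F1"
  proof -
    have "F \<subseteq> (\<lambda>X. if X \<in> F then X else insert x X) ` F0 \<union> insert x ` F1"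
    proof
      fix X assume X: "X \<in> F"
      have *: "x \<in> X \<Longrightarrow> insert x (X - {x}) = X" by auto
      show "X \<in> (\<lambda>X. if X \<in> F then X else insert x X) ` F0 \<union> insert x ` F1"
      proof (cases "x \<in> X \<and> X - {x} \<in> F")
        case True
        have "X - {x} \<in> F1" using True X insert.prems * by (auto simp: F1_def)
        then show ?thesis using * True by (intro UnI2 image_eqI[of _ _ "X - {x}"]) auto
      next
        case False
        have "X = (\<lambda>X. if X \<in> F then X else insert x X) (X - {x})"
        proof (cases "x \<in> X")
          case True
          then show ?thesis using False * by auto
        next
          case False
          then have "X - {x} = X" by auto
          then show ?thesis using X by simp
        qed
        then show ?thesis using X unfolding F0_def by blast
      qed
    qed
    then have "card F \<le> card ((\<lambda>X. if X \<in> F then X else insert x X) ` F0 \<union> insert x ` F1)"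
      using fin by (intro card_mono) auto
    also have "\<dots> \<le> card F0 + card F1"
      by (meson add_mono card_Un_le card_image_le fin le_trans)
    finally show ?thesis .
  qed
  also have "\<dots> \<le> card (?sh F0) + card (?sh F1)"
    using insert.IH[OF F0] insert.IH[OF F1] by linarith
  also have "\<dots> = card (?sh F0) + card (insert x ` ?sh F1)"
  proof -
    have "inj_on (insert x) (?sh F1)" using insert.hyps by (auto simp: inj_on_def)
    then show ?thesis by (simp add: card_image)
  qed
  also have "\<dots> = card (?sh F0 \<union> insert x ` ?sh F1)"
    using insert.hyps by (intro card_Un_disjoint[symmetric]) auto
  also have "\<dots> \<le> card {S. S \<subseteq> insert x U \<and> shatters F S}"
  proof (rule card_mono)
    show "?sh F0 \<union> insert x ` ?sh F1 \<subseteq> {S. S \<subseteq> insert x U \<and> shatters F S}"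
    proof (rule Un_least)
      show "?sh F0 \<subseteq> {S. S \<subseteq> insert x U \<and> shatters F S}"
      proof clarify
        fix S assume S: "S \<subseteq> U" "shatters F0 S"
        have "\<exists>X\<in>F. X \<inter> S = T" if "T \<subseteq> S" for T
        proof -
          obtain X where "X \<in> F" "(X - {x}) \<inter> S = T"
            using S(2) \<open>T \<subseteq> S\<close> unfolding shatters_def F0_def by blast
          moreover have "x \<notin> S" using S insert.hyps by auto
          ultimately show ?thesis by blast
        qed
        then show "S \<subseteq> insert x U \<and> shatters F S" using S by (auto simp: shatters_def)
      qed
      show "insert x ` ?sh F1 \<subseteq> {S. S \<subseteq> insert x U \<and> shatters F S}"
      proof clarify
        fix S assume S: "S \<subseteq> U" "shatters F1 S"
        have xS: "x \<notin> S" using S insert.hyps by auto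
        have "\<exists>X\<in>F. X \<inter> insert x S = T" if T: "T \<subseteq> insert x S" for T
        proof -
          have "T - {x} \<subseteq> S" using T by auto
          then obtain X where X: "X \<in> F1" "X \<inter> S = T - {x}"
            using S(2) unfolding shatters_def by blast
          have "x \<notin> X" "X \<in> F" "insert x X \<in> F" using X insert.hyps by (auto simp: F1_def)
          show ?thesis
          proof (cases "x \<in> T")
            case True
            then have "insert x X \<inter> insert x S = T" using X(2) by blast
            then show ?thesis using \<open>insert x X \<in> F\<close> by blast
          next
            case False
            then have "X \<inter> insert x S = T" using X(2) \<open>x \<notin> X\<close> by blast
            then show ?thesis using \<open>X \<in> F\<close> by blast
          qed
        qed
        then show "insert x S \<subseteq> insert x U \<and> shatters F (insert x S)"
          using S by (auto simp: shatters_def)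
      qed
    qed
    show "finite {S. S \<subseteq> insert x U \<and> shatters F S}"
      using insert.hyps by (auto intro: finite_subset[of _ "Pow (insert x U)"])
  qed
  finally show ?case .
qed

section \<open>Counting graphs without a complete multipartite subgraph\<close>

text \<open>The edge set \<open>E\<close> contains the complete \<open>r\<close>-partite graph with parts \<open>A 0, \<dots>, A (r - 1)\<close> of size
  \<open>t\<close>. Disjointness of the parts is automatic when \<open>E\<close> has no loops.\<close>

definition multipartite_at :: "'a set set \<Rightarrow> nat \<Rightarrow> nat \<Rightarrow> (nat \<Rightarrow> 'a set) \<Rightarrow> bool" where
  "multipartite_at E r t A \<longleftrightarrow>
     (\<forall>i<r. card (A i) = t) \<and>
     (\<forall>i<r. \<forall>j<r. i \<noteq> j \<longrightarrow> (\<forall>a\<in>A i. \<forall>b\<in>A j. {a, b} \<in> E))"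

text \<open>The requirement that the parts lie in \<open>V\<close> matters for \<open>r = 1\<close>, where no edge forces it.\<close>

definition multipartite_free :: "'a set \<Rightarrow> nat \<Rightarrow> nat \<Rightarrow> 'a set set set" where
  "multipartite_free V r t =
     {E. E \<subseteq> all_edges V \<and> \<not> (\<exists>A. (\<forall>i<r. A i \<subseteq> V) \<and> multipartite_at E r t A)}"

lemma finite_all_edges: "finite V \<Longrightarrow> finite (all_edges V)"
  by (rule finite_subset[of _ "Pow V"]) (auto simp: all_edges_def)

lemma card_all_edges: "finite V \<Longrightarrow> card (all_edges V) = card V choose 2"
  by (simp add: all_edges_def n_subsets)

lemma card_all_edges_le: "finite V \<Longrightarrow> card (all_edges V) \<le> (card V)\<^sup>2"
proof -
  assume "finite V"
  then have "card (all_edges V) = card V * (card V - 1) div 2"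
    by (simp add: card_all_edges choose_two)
  also have "\<dots> \<le> card V * (card V - 1)" by (rule div_le_dividend)
  also have "\<dots> \<le> (card V)\<^sup>2" by (simp add: power2_eq_square)
  finally show ?thesis .
qed

lemma doubleton_in_all_edges: "{a, b} \<in> all_edges V \<longleftrightarrow> a \<in> V \<and> b \<in> V \<and> a \<noteq> b"
  by (auto simp: all_edges_def card_insert_if)

lemma multipartite_free_subset: "multipartite_free V r t \<subseteq> Pow (all_edges V)"
  by (auto simp: multipartite_free_def)

lemma finite_multipartite_free: "finite V \<Longrightarrow> finite (multipartite_free V r t)"
  by (rule finite_subset[OF multipartite_free_subset]) (simp add: finite_all_edges)

lemma card_multipartite_free_le:
  assumes "finite V" shows "card (multipartite_free V r t) \<le> 2 ^ (card V)\<^sup>2"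
proof -
  have "card (multipartite_free V r t) \<le> 2 ^ card (all_edges V)"
    using card_mono[OF _ multipartite_free_subset, of V r t] finite_all_edges[OF assms]
    by (simp add: card_Pow)
  also have "\<dots> \<le> 2 ^ (card V)\<^sup>2"
    by (intro power_increasing card_all_edges_le assms) auto
  finally show ?thesis .
qed

lemma card_small_subsets_le:
  assumes "finite A"
  shows "card {B. B \<subseteq> A \<and> card B < t} \<le> (card A + 1) ^ t"
proof (induction t)
  case (Suc t)
  show ?case
  proof (cases "t = 0")
    case True
    have "{B. B \<subseteq> A \<and> card B < Suc 0} = {{}}"
      using finite_subset[OF _ assms] by auto
    then show ?thesis using True by simp
  next
    case False
    have "{B. B \<subseteq> A \<and> card B < Suc t} = {B. B \<subseteq> A \<and> card B < t} \<union> {B. B \<subseteq> A \<and> card B = t}"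
      by auto
    then have "card {B. B \<subseteq> A \<and> card B < Suc t}
        \<le> card {B. B \<subseteq> A \<and> card B < t} + card {B. B \<subseteq> A \<and> card B = t}"
      by (simp add: card_Un_le)
    also have "\<dots> \<le> (card A + 1) ^ t + card A * (card A + 1) ^ t"
    proof (rule add_mono[OF Suc])
      have "card {B. B \<subseteq> A \<and> card B = t} = card A choose t" by (rule n_subsets[OF assms])
      also have "\<dots> \<le> card A * (card A + 1) ^ t"
      proof (cases "t > card A")
        case notgt: False
        then have "card A choose t \<le> card A ^ t" by (intro binomial_le_pow) auto
        also have "\<dots> \<le> (card A + 1) ^ t" by (intro power_mono) auto
        also have "\<dots> \<le> card A * (card A + 1) ^ t" using False notgt by simp
        finally show ?thesis .
      qed (auto simp: binomial_eq_0)
      finally show "card {B. B \<subseteq> A \<and> card B = t} \<le> card A * (card A + 1) ^ t" .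
    qed
    finally show ?thesis by simp
  qed
qed auto

text \<open>The possible neighbourhoods, in a multipartite graph on \<open>U\<close>, of a typical outside
  vertex: only polynomially many choices in \<open>s\<close> remain in one of the parts, so the exponent drops from \<open>r s\<close> to \<open>(r - 1) s\<close>.\<close>

lemma card_sets_meeting_some_part_in_few_le:
  assumes "finite U" "\<And>i. i < r \<Longrightarrow> A i \<subseteq> U" "\<And>i. i < r \<Longrightarrow> card (A i) = s" "card U = r * s"
  shows "card {B. B \<subseteq> U \<and> (\<exists>i<r. card (B \<inter> A i) < t)} \<le> r * ((s + 1) ^ t * 2 ^ ((r - 1) * s))"
proof -
  have "card {B. B \<subseteq> U \<and> card (B \<inter> A i) < t} \<le> (s + 1) ^ t * 2 ^ ((r - 1) * s)" if "i < r" for i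
  proof -
    have fA: "finite (A i)" using finite_subset[OF assms(2)[OF that] assms(1)] .
    let ?f = "\<lambda>B. (B \<inter> A i, B - A i)"
    have "card {B. B \<subseteq> U \<and> card (B \<inter> A i) < t}
        \<le> card ({B. B \<subseteq> A i \<and> card B < t} \<times> Pow (U - A i))"
    proof (rule card_inj_on_le[of ?f])
      show "inj_on ?f {B. B \<subseteq> U \<and> card (B \<inter> A i) < t}"
        by (auto simp: inj_on_def)
      show "finite ({B. B \<subseteq> A i \<and> card B < t} \<times> Pow (U - A i))"
        using assms(1) fA by (auto intro: finite_subset[of _ "Pow (A i)"])
    qed auto
    also have "\<dots> = card {B. B \<subseteq> A i \<and> card B < t} * 2 ^ card (U - A i)"
      using assms(1) by (simp add: card_cartesian_product card_Pow)
    also have "card (U - A i) = (r - 1) * s"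
      using assms that fA by (simp add: card_Diff_subset diff_mult_distrib)
    also have "card {B. B \<subseteq> A i \<and> card B < t} \<le> (s + 1) ^ t"
      using card_small_subsets_le[OF fA, of t] assms(3)[OF that] by simp
    finally show ?thesis by simp
  qed
  note * = this
  have "{B. B \<subseteq> U \<and> (\<exists>i<r. card (B \<inter> A i) < t)} = (\<Union>i<r. {B. B \<subseteq> U \<and> card (B \<inter> A i) < t})"
    by auto
  then have "card {B. B \<subseteq> U \<and> (\<exists>i<r. card (B \<inter> A i) < t)}
      \<le> (\<Sum>i<r. card {B. B \<subseteq> U \<and> card (B \<inter> A i) < t})"
    using card_UN_le[of "{..<r}" "\<lambda>i. {B. B \<subseteq> U \<and> card (B \<inter> A i) < t}"] by simp
  also have "\<dots> \<le> (\<Sum>i<r. (s + 1) ^ t * 2 ^ ((r - 1) * s))" by (intro sum_mono *) auto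
  finally show ?thesis by simp
qed

text \<open>The set of exceptional arguments is chosen in at most \<open>2 ^ card W\<close> ways. This crude
  count is harmless later: it contributes one bit per vertex, against a gain that grows with the part size.\<close>

lemma card_functions_with_few_exceptions_le:
  assumes "finite W" "finite P" "Q \<subseteq> P" "Q \<noteq> {}"
  shows "card {g \<in> W \<rightarrow>\<^sub>E P. card {v\<in>W. g v \<notin> Q} \<le> m} \<le> 2 ^ card W * (card P ^ m * card Q ^ card W)"
proof -
  let ?X = "{X. X \<subseteq> W \<and> card X \<le> m}"
  let ?H = "\<lambda>X. PiE W (\<lambda>v. if v \<in> X then P else Q)"
  have fQ: "finite Q" using assms finite_subset by auto
  have fX: "finite ?X" using assms by (auto intro: finite_subset[of _ "Pow W"])
  have "{g \<in> W \<rightarrow>\<^sub>E P. card {v\<in>W. g v \<notin> Q} \<le> m} \<subseteq> (\<Union>X\<in>?X. ?H X)"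
  proof clarify
    fix g assume g: "g \<in> W \<rightarrow>\<^sub>E P" "card {v\<in>W. g v \<notin> Q} \<le> m"
    then have "g \<in> ?H {v\<in>W. g v \<notin> Q}" by (auto simp: PiE_iff)
    moreover have "{v\<in>W. g v \<notin> Q} \<in> ?X" using g by auto
    ultimately show "g \<in> (\<Union>X\<in>?X. ?H X)" by (rule UN_I[rotated])
  qed
  then have "card {g \<in> W \<rightarrow>\<^sub>E P. card {v\<in>W. g v \<notin> Q} \<le> m} \<le> card (\<Union>X\<in>?X. ?H X)"
    using fX assms fQ by (intro card_mono finite_UN_I finite_PiE) (auto split: if_splits)
  also have "\<dots> \<le> (\<Sum>X\<in>?X. card (?H X))" by (rule card_UN_le[OF fX])
  also have "\<dots> \<le> (\<Sum>X\<in>?X. card P ^ m * card Q ^ card W)"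
  proof (rule sum_mono)
    fix X assume X: "X \<in> ?X"
    have Q1: "1 \<le> card Q" using assms fQ by (simp add: Suc_le_eq card_gt_0_iff)
    have P1: "1 \<le> card P" using Q1 card_mono[OF assms(2,3)] by simp
    have "card (?H X) = (\<Prod>v\<in>W. if v \<in> X then card P else card Q)"
      using assms by (simp add: card_PiE if_distrib)
    also have "\<dots> = card P ^ card (W \<inter> X) * card Q ^ card (W \<inter> - X)"
      using assms by (simp add: prod.If_cases)
    also have "\<dots> \<le> card P ^ m * card Q ^ card W"
    proof (rule mult_mono)
      have "card (W \<inter> X) \<le> m" using X by (simp add: Int_absorb1)
      then show "card P ^ card (W \<inter> X) \<le> card P ^ m" using P1 by (rule power_increasing)
      show "card Q ^ card (W \<inter> - X) \<le> card Q ^ card W"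
        using assms by (intro power_increasing card_mono Q1) auto
    qed auto
    finally show "card (?H X) \<le> card P ^ m * card Q ^ card W" .
  qed
  also have "\<dots> = card ?X * (card P ^ m * card Q ^ card W)" by simp
  also have "\<dots> \<le> 2 ^ card W * (card P ^ m * card Q ^ card W)"
  proof (rule mult_right_mono)
    have "card ?X \<le> card (Pow W)" using assms by (intro card_mono) auto
    then show "card ?X \<le> 2 ^ card W" using assms by (simp add: card_Pow)
  qed auto
  finally show ?thesis .
qed

lemma multipartite_at_mono: "multipartite_at E r t A \<Longrightarrow> E \<subseteq> E' \<Longrightarrow> multipartite_at E' r t A"
  unfolding multipartite_at_def by blast

lemma multipartite_at_parts:
  assumes "multipartite_at E r s A" "E \<subseteq> all_edges V" "s \<ge> 1"
  shows "\<And>i. i < r \<Longrightarrow> finite (A i)" and "\<And>i j. i < r \<Longrightarrow> j < r \<Longrightarrow> i \<noteq> j \<Longrightarrow> A i \<inter> A j = {}"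
    and "card (\<Union>i<r. A i) = r * s"
proof -
  show fin: "finite (A i)" if "i < r" for i
    using assms that by (intro card_ge_0_finite) (auto simp: multipartite_at_def)
  show dis: "A i \<inter> A j = {}" if ij: "i < r" "j < r" "i \<noteq> j" for i j
  proof -
    have False if "x \<in> A i" "x \<in> A j" for x
    proof -
      have "{x, x} \<in> all_edges V"
        using assms ij that unfolding multipartite_at_def by blast
      then show False by (simp add: all_edges_def)
    qed
    then show "A i \<inter> A j = {}" by blast
  qed
  have "card (\<Union>i<r. A i) = (\<Sum>i<r. card (A i))"
    using fin dis by (intro card_UN_disjoint) auto
  then show "card (\<Union>i<r. A i) = r * s"
    using assms(1) by (simp add: multipartite_at_def)
qed

text \<open>Shrinking the parts to \<open>t\<close> common neighbours each, \<open>t\<close> vertices of \<open>Z\<close> would form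
  one further part.\<close>

lemma few_vertices_with_equal_large_trace:
  assumes E: "E \<in> multipartite_free V (Suc r) t" and at: "multipartite_at E r s A"
    and AV: "\<And>i. i < r \<Longrightarrow> A i \<subseteq> V" and "Z \<subseteq> V"
    and B: "\<And>i. i < r \<Longrightarrow> t \<le> card (B \<inter> A i)"
    and Z: "\<And>u v. u \<in> B \<Longrightarrow> v \<in> Z \<Longrightarrow> {u, v} \<in> E"
  shows "card Z \<le> t"
proof (rule ccontr)
  assume "\<not> card Z \<le> t"
  then obtain Z' where Z': "Z' \<subseteq> Z" "card Z' = t"
    by (metis nle_le obtain_subset_with_card_n)
  have "\<exists>C. C \<subseteq> B \<inter> A i \<and> card C = t" if "i < r" for i
    using B[OF that] by (metis obtain_subset_with_card_n)
  then obtain C where C: "\<And>i. i < r \<Longrightarrow> C i \<subseteq> B \<inter> A i \<and> card (C i) = t" by metis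
  define A' where "A' = C(r := Z')"
  have "multipartite_at E (Suc r) t A'"
    unfolding multipartite_at_def
  proof (intro conjI allI impI ballI)
    fix i assume "i < Suc r"
    then show "card (A' i) = t" using C Z' by (cases "i = r") (auto simp: A'_def)
  next
    fix i j a b assume *: "i < Suc r" "j < Suc r" "i \<noteq> j" "a \<in> A' i" "b \<in> A' j"
    consider "i = r" "j < r" | "i < r" "j = r" | "i < r" "j < r" using * by linarith
    then show "{a, b} \<in> E"
    proof cases
      case 1
      then have "b \<in> B" "a \<in> Z" using * C[of j] Z' by (auto simp: A'_def)
      then show ?thesis using Z[of b a] by (simp add: insert_commute)
    next
      case 2
      then have "a \<in> B" "b \<in> Z" using * C[of i] Z' by (auto simp: A'_def)
      then show ?thesis using Z[of a b] by simp
    next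
      case 3
      then have "a \<in> A i" "b \<in> A j" using * C[of i] C[of j] by (auto simp: A'_def)
      then show ?thesis using at 3 * unfolding multipartite_at_def by blast
    qed
  qed
  moreover have "A' i \<subseteq> V" if "i < Suc r" for i
    using that C[of i] AV[of i] Z' \<open>Z \<subseteq> V\<close> by (cases "i = r") (auto simp: A'_def)
  ultimately show False using E unfolding multipartite_free_def by blast
qed

text \<open>A graph with the given multipartite subgraph on \<open>U\<close> is determined by its edges inside \<open>U\<close>, its
  edges outside \<open>U\<close>, and the trace on \<open>U\<close> of the neighbourhood of each outside vertex. Traces meeting
  every part in at least \<open>t\<close> vertices are each taken at most \<open>t\<close> times, hence occur at most \<open>t * 2 ^ q\<close>
  times altogether.\<close>

lemma card_extensions_of_multipartite_le:
  fixes V :: "'a set"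
  assumes fV: "finite V" and r: "r \<ge> 1" and s: "s \<ge> 1" and t: "t \<ge> 1"
    and AV: "\<And>i. i < r \<Longrightarrow> A i \<subseteq> V"
  defines "U \<equiv> \<Union>i<r. A i" and "q \<equiv> r * s"
  shows "card {E \<in> multipartite_free V (Suc r) t. multipartite_at E r s A}
     \<le> 2 ^ q\<^sup>2 * (2 ^ card V * ((2 ^ q) ^ (t * 2 ^ q) * (r * ((s + 1) ^ t * 2 ^ ((r - 1) * s))) ^ card V))
        * card (multipartite_free (V - U) (Suc r) t)"
    (is "card ?S \<le> _")
proof (cases "?S = {}")
  case True
  show ?thesis unfolding True by simp
next
  case False
  then obtain E0 where E0: "E0 \<in> multipartite_free V (Suc r) t" "multipartite_at E0 r s A" by blast
  then have "E0 \<subseteq> all_edges V" by (simp add: multipartite_free_def)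
  note parts = multipartite_at_parts[OF E0(2) this s]
  have UV: "U \<subseteq> V" using AV unfolding U_def by blast
  have fU: "finite U" and cU: "card U = q"
    using parts by (auto simp: U_def q_def)
  have AU: "A i \<subseteq> U" if "i < r" for i using that by (auto simp: U_def)
  have cA: "card (A i) = s" if "i < r" for i using that E0 by (simp add: multipartite_at_def)
  define W where "W = V - U"
  have fW: "finite W" and WV: "W \<subseteq> V" using fV by (auto simp: W_def)
  define Q where "Q = {B. B \<subseteq> U \<and> (\<exists>i<r. card (B \<inter> A i) < t)}"
  define G where "G = r * ((s + 1) ^ t * 2 ^ ((r - 1) * s))"
  define trace where "trace = (\<lambda>E. \<lambda>v\<in>W. {u\<in>U. {u, v} \<in> E})"
  define Tr where "Tr = {g \<in> W \<rightarrow>\<^sub>E Pow U. card {v\<in>W. g v \<notin> Q} \<le> t * 2 ^ q}"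
  let ?f = "\<lambda>E. (E \<inter> all_edges U, trace E, E \<inter> all_edges W)"
  let ?R = "Pow (all_edges U) \<times> Tr \<times> multipartite_free W (Suc r) t"
  have fTr: "finite Tr"
    using fW fU by (auto simp: Tr_def intro: finite_subset[OF _ finite_PiE[of W "\<lambda>_. Pow U"]])
  have "card ?S \<le> card ?R"
  proof (rule card_inj_on_le[of ?f])
    show "finite ?R"
      using fTr fU fW by (simp add: finite_all_edges finite_multipartite_free)
    have sub: "E \<subseteq> E'" if "E \<subseteq> all_edges V" "?f E = ?f E'" for E E'
    proof
      fix e assume e: "e \<in> E"
      then have "e \<in> all_edges V" using that by blast
      then obtain a b where ab: "e = {a, b}" "a \<noteq> b" "a \<in> V" "b \<in> V"
        by (auto simp: all_edges_def card_2_iff)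
      have tr: "{u, v} \<in> E'" if "u \<in> U" "v \<in> W" "{u, v} \<in> E" for u v
      proof -
        have "trace E v = trace E' v" using \<open>?f E = ?f E'\<close> by simp
        then show ?thesis using that by (auto simp: trace_def)
      qed
      consider "a \<in> U" "b \<in> U" | "a \<in> W" "b \<in> W" | "a \<in> U" "b \<in> W" | "a \<in> W" "b \<in> U"
        using ab by (auto simp: W_def)
      then show "e \<in> E'"
      proof cases
        case 1
        then have "e \<in> E \<inter> all_edges U" using e ab by (simp add: doubleton_in_all_edges)
        then show ?thesis using that by auto
      next
        case 2
        then have "e \<in> E \<inter> all_edges W" using e ab by (simp add: doubleton_in_all_edges)
        then show ?thesis using that by auto
      next
        case 3
        then show ?thesis using tr e ab by auto
      next
        case 4
        then show ?thesis using tr[of b a] e ab by (simp add: insert_commute)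
      qed
    qed
    show "inj_on ?f ?S"
    proof (rule inj_onI)
      fix E E' assume "E \<in> ?S" "E' \<in> ?S" "?f E = ?f E'"
      then show "E = E'" using sub[of E E'] sub[of E' E]
        by (simp add: multipartite_free_def subset_antisym)
    qed
    show "?f ` ?S \<subseteq> ?R"
    proof (rule image_subsetI)
      fix E assume "E \<in> ?S"
      then have E: "E \<in> multipartite_free V (Suc r) t" "multipartite_at E r s A" by simp_all
      have EW: "E \<inter> all_edges W \<in> multipartite_free W (Suc r) t"
        unfolding multipartite_free_def
      proof (intro CollectI conjI notI)
        show "E \<inter> all_edges W \<subseteq> all_edges W" by blast
        assume "\<exists>A. (\<forall>i<Suc r. A i \<subseteq> W) \<and> multipartite_at (E \<inter> all_edges W) (Suc r) t A"
        then obtain A where "\<forall>i<Suc r. A i \<subseteq> W" "multipartite_at (E \<inter> all_edges W) (Suc r) t A"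
          by blast
        then have "(\<forall>i<Suc r. A i \<subseteq> V) \<and> multipartite_at E (Suc r) t A"
          using WV multipartite_at_mono by blast
        then show False using E(1) unfolding multipartite_free_def by blast
      qed
      have tr: "trace E \<in> W \<rightarrow>\<^sub>E Pow U" by (auto simp: trace_def)
      have "{v\<in>W. trace E v \<notin> Q} \<subseteq> (\<Union>B\<in>Pow U - Q. {v\<in>W. trace E v = B})"
        using tr by (auto simp: PiE_iff)
      then have "card {v\<in>W. trace E v \<notin> Q} \<le> card (\<Union>B\<in>Pow U - Q. {v\<in>W. trace E v = B})"
        using fW fU by (intro card_mono) auto
      also have "\<dots> \<le> (\<Sum>B\<in>Pow U - Q. card {v\<in>W. trace E v = B})"
        using fU by (intro card_UN_le) auto
      also have "\<dots> \<le> (\<Sum>B\<in>Pow U - Q. t)"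
      proof (rule sum_mono)
        fix B assume B: "B \<in> Pow U - Q"
        show "card {v\<in>W. trace E v = B} \<le> t"
        proof (rule few_vertices_with_equal_large_trace[OF E AV])
          show "{v\<in>W. trace E v = B} \<subseteq> V" using WV by auto
          show "t \<le> card (B \<inter> A i)" if "i < r" for i
          proof -
            have "\<not> card (B \<inter> A i) < t" using B that unfolding Q_def by blast
            then show ?thesis by simp
          qed
          show "{u, v} \<in> E" if "u \<in> B" "v \<in> {v\<in>W. trace E v = B}" for u v
            using that by (auto simp: trace_def)
        qed
      qed
      also have "\<dots> \<le> card (Pow U) * t"
        using fU by (simp add: card_mono)
      also have "\<dots> = t * 2 ^ q" using fU cU by (simp add: card_Pow)
      finally have "trace E \<in> Tr" using tr by (simp add: Tr_def)
      then show "?f E \<in> ?R" using EW by simp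
    qed
  qed
  also have "card ?R = 2 ^ card (all_edges U) * card Tr * card (multipartite_free W (Suc r) t)"
    using fU by (simp add: card_cartesian_product card_Pow finite_all_edges)
  also have "\<dots> \<le> 2 ^ q\<^sup>2 * (2 ^ card V * ((2 ^ q) ^ (t * 2 ^ q) * G ^ card V))
        * card (multipartite_free W (Suc r) t)"
  proof (intro mult_mono order_refl)
    show "(2::nat) ^ card (all_edges U) \<le> 2 ^ q\<^sup>2"
      using card_all_edges_le[OF fU] cU by (intro power_increasing) auto
    have Q0: "{} \<in> Q" using r t by (auto simp: Q_def intro!: exI[of _ 0])
    have "card Tr \<le> 2 ^ card W * (card (Pow U) ^ (t * 2 ^ q) * card Q ^ card W)"
      unfolding Tr_def
    proof (rule card_functions_with_few_exceptions_le[OF fW])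
      show "finite (Pow U)" using fU by simp
      show "Q \<subseteq> Pow U" by (auto simp: Q_def)
      show "Q \<noteq> {}" using Q0 by blast
    qed
    also have "\<dots> \<le> 2 ^ card V * ((2 ^ q) ^ (t * 2 ^ q) * G ^ card V)"
    proof (intro mult_mono)
      have WVc: "card W \<le> card V" by (rule card_mono[OF fV WV])
      then show "(2::nat) ^ card W \<le> 2 ^ card V" by (intro power_increasing) auto
      show "card (Pow U) ^ (t * 2 ^ q) \<le> (2 ^ q) ^ (t * 2 ^ q)" using fU cU by (simp add: card_Pow)
      have "card Q \<le> G"
        unfolding Q_def G_def
        using fU AU cA cU by (intro card_sets_meeting_some_part_in_few_le) (auto simp: q_def)
      then have "card Q ^ card W \<le> G ^ card W" by (intro power_mono) auto
      also have "\<dots> \<le> G ^ card V" using r by (intro power_increasing WVc) (auto simp: G_def Suc_le_eq)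
      finally show "card Q ^ card W \<le> G ^ card V" .
    qed auto
    finally show "card Tr \<le> 2 ^ card V * ((2 ^ q) ^ (t * 2 ^ q) * G ^ card V)" .
  qed auto
  finally show ?thesis by (simp add: W_def G_def)
qed

text \<open>The recursion for the count. The sum over all choices of the parts is bounded by
  \<open>2 ^ (r * card V)\<close> equal terms; again this costs only a constant number of bits per vertex.\<close>

lemma card_multipartite_free_Suc_le:
  fixes V :: "'a set"
  assumes fV: "finite V" and r: "r \<ge> 1" and s: "s \<ge> 1" and t: "t \<ge> 1"
    and K: "\<And>W. W \<subset> V \<Longrightarrow> card W = card V - r * s \<Longrightarrow> r * s \<le> card V \<Longrightarrow>
       real (card (multipartite_free W (Suc r) t)) \<le> K" "K \<ge> 0"
  shows "real (card (multipartite_free V (Suc r) t)) \<le> real (card (multipartite_free V r s)) +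
     2 ^ (r * card V) * (2 ^ (r * s)\<^sup>2 * (2 ^ card V * ((2 ^ (r * s)) ^ (t * 2 ^ (r * s)) *
        (real r * ((real s + 1) ^ t * 2 ^ ((r - 1) * s))) ^ card V)) * K)"
proof -
  let ?F = "multipartite_free V (Suc r) t"
  let ?P = "{..<r} \<rightarrow>\<^sub>E Pow V"
  let ?S = "\<lambda>A. {E \<in> ?F. multipartite_at E r s A}"
  define b where "b = (2::real) ^ (r * s)\<^sup>2 * (2 ^ card V * ((2 ^ (r * s)) ^ (t * 2 ^ (r * s)) *
        (real r * ((real s + 1) ^ t * 2 ^ ((r - 1) * s))) ^ card V))"
  have b0: "b \<ge> 0" by (simp add: b_def)
  have fin: "finite ?P" using fV by (intro finite_PiE) auto
  have "?F \<subseteq> multipartite_free V r s \<union> (\<Union>A\<in>?P. ?S A)"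
  proof
    fix E assume E: "E \<in> ?F"
    show "E \<in> multipartite_free V r s \<union> (\<Union>A\<in>?P. ?S A)"
    proof (cases "E \<in> multipartite_free V r s")
      case False
      then obtain A where A: "\<forall>i<r. A i \<subseteq> V" "multipartite_at E r s A"
        using E by (auto simp: multipartite_free_def)
      have "restrict A {..<r} \<in> ?P" using A by auto
      moreover have "multipartite_at E r s (restrict A {..<r})"
        using A(2) by (simp add: multipartite_at_def)
      ultimately show ?thesis using E by blast
    qed auto
  qed
  then have "card ?F \<le> card (multipartite_free V r s \<union> (\<Union>A\<in>?P. ?S A))"
    using fin fV by (intro card_mono) (auto simp: finite_multipartite_free)
  also have "\<dots> \<le> card (multipartite_free V r s) + (\<Sum>A\<in>?P. card (?S A))"
    by (intro order_trans[OF card_Un_le] add_mono order_refl card_UN_le fin)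
  finally have "real (card ?F) \<le> real (card (multipartite_free V r s) + (\<Sum>A\<in>?P. card (?S A)))"
    by (rule of_nat_mono)
  also have "\<dots> = real (card (multipartite_free V r s)) + (\<Sum>A\<in>?P. real (card (?S A)))"
    by simp
  also have "(\<Sum>A\<in>?P. real (card (?S A))) \<le> (\<Sum>A\<in>?P. b * K)"
  proof (rule sum_mono)
    fix A assume A: "A \<in> ?P"
    show "real (card (?S A)) \<le> b * K"
    proof (cases "?S A = {}")
      case True
      then show ?thesis using b0 K(2) by (simp only: True) simp
    next
      case False
      then obtain E where E: "E \<in> ?F" "multipartite_at E r s A" by blast
      then have "E \<subseteq> all_edges V" by (simp add: multipartite_free_def)
      note cU = multipartite_at_parts(3)[OF E(2) this s]
      let ?W = "V - (\<Union>i<r. A i)"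
      have AV: "\<And>i. i < r \<Longrightarrow> A i \<subseteq> V" using A by (auto simp: PiE_iff)
      then have UV: "(\<Union>i<r. A i) \<subseteq> V" by auto
      have "(\<Union>i<r. A i) \<noteq> {}" using cU r s by (metis card.empty mult_is_0 not_one_le_zero)
      then have "?W \<subset> V" using UV by blast
      moreover have "card ?W = card V - r * s"
        using UV cU fV by (simp add: card_Diff_subset finite_subset)
      moreover have "r * s \<le> card V" using card_mono[OF fV UV] cU by simp
      ultimately have WK: "real (card (multipartite_free ?W (Suc r) t)) \<le> K" by (rule K(1))
      have "real (card (?S A)) \<le> b * real (card (multipartite_free ?W (Suc r) t))"
        using of_nat_mono[OF card_extensions_of_multipartite_le[where A = A, OF fV r s t AV], where ?'a=real]
        by (simp add: b_def add.commute[of "real s" 1])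
      also have "\<dots> \<le> b * K" by (rule mult_left_mono[OF WK b0])
      finally show ?thesis .
    qed
  qed
  also have "(\<Sum>A\<in>?P. b * K) = 2 ^ (r * card V) * (b * K)"
  proof -
    have "card ?P = (2 ^ card V) ^ r" using fV by (simp add: card_PiE card_Pow)
    also have "\<dots> = 2 ^ (r * card V)" by (simp add: mult.commute flip: power_mult)
    finally show ?thesis by simp
  qed
  finally show ?thesis by (simp add: b_def)
qed

text \<open>The part size at which the linear gain overtakes the logarithmic cost of recording
  sparse neighbourhoods.\<close>

lemma exists_large_part_size:
  fixes \<epsilon> c :: real
  assumes "\<epsilon> > 0"
  shows "\<exists>s\<ge>1. c + real t * log 2 (real s + 1) \<le> \<epsilon> * real s"
proof -
  have "(\<lambda>s. (c + real t * log 2 (real s + 1)) / real s) \<longlonglongrightarrow> 0"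
    by real_asymp
  then have "eventually (\<lambda>s. (c + real t * log 2 (real s + 1)) / real s < \<epsilon>) sequentially"
    using assms by (rule order_tendstoD(2))
  then have "eventually (\<lambda>s. s \<ge> 1 \<and> (c + real t * log 2 (real s + 1)) / real s < \<epsilon>) sequentially"
    using eventually_ge_at_top[of 1] by eventually_elim simp
  then obtain s where s: "s \<ge> 1" "(c + real t * log 2 (real s + 1)) / real s < \<epsilon>"
    by (auto simp: eventually_sequentially)
  then have "c + real t * log 2 (real s + 1) \<le> \<epsilon> * real s"
    by (simp add: divide_simps split: if_splits)
  then show ?thesis using s by blast
qed

text \<open>The number of parts is \<open>Suc k\<close>. The density \<open>real (k - 1) / real k\<close> is that of the extremal graph with \<open>k\<close>
  classes; for \<open>k = 0\<close> it is \<open>0\<close> by the convention on division by zero, as the induction needs. The additive constant \<open>C\<close>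
  absorbs all small vertex sets, so that the bound holds for every \<open>V\<close> and the recursion can be iterated down to
  the empty set.\<close>

theorem card_multipartite_free_le_powr:
  fixes \<epsilon> :: real
  assumes "\<epsilon> > 0" and "t \<ge> 1"
  shows "\<exists>C. \<forall>V :: 'a set. finite V \<longrightarrow> real (card (multipartite_free V (Suc k) t))
           \<le> 2 powr ((real (k - 1) / real k + \<epsilon>) * (real (card V))\<^sup>2 / 2 + C)"
  using assms(2)
proof (induction k arbitrary: t)
  case 0
  show ?case
  proof (intro exI allI impI)
    fix V :: "'a set" assume fV: "finite V"
    show "real (card (multipartite_free V (Suc 0) t))
           \<le> 2 powr ((real (0 - 1) / real 0 + \<epsilon>) * (real (card V))\<^sup>2 / 2 + (real t)\<^sup>2)"
    proof (cases "card V < t")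
      case True
      have "real (card (multipartite_free V (Suc 0) t)) \<le> 2 ^ (card V)\<^sup>2"
        using of_nat_mono[OF card_multipartite_free_le[OF fV], where ?'a=real] by simp
      also have "\<dots> = 2 powr (real (card V))\<^sup>2" by (simp flip: powr_realpow)
      also have "\<dots> \<le> 2 powr ((real (0 - 1) / real 0 + \<epsilon>) * (real (card V))\<^sup>2 / 2 + (real t)\<^sup>2)"
        using True assms(1) power_mono[of "real (card V)" "real t" 2]
        by (intro powr_mono) (auto intro: add_increasing)
      finally show ?thesis .
    next
      case False
      then obtain A where "A \<subseteq> V" "card A = t" by (metis not_less obtain_subset_with_card_n)
      then have "\<exists>A. (\<forall>i<Suc 0. A i \<subseteq> V) \<and> multipartite_at E (Suc 0) t A" for E
        by (intro exI[of _ "\<lambda>_. A"]) (simp add: multipartite_at_def)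
      then have "multipartite_free V (Suc 0) t = {}" by (simp add: multipartite_free_def)
      then show ?thesis by simp
    qed
  qed
next
  case (Suc k)
  define r where "r = Suc k"
  have r: "r \<ge> 1" and t: "t \<ge> 1" using Suc.prems by (auto simp: r_def)
  \<comment> \<open>Cost in bits per remaining vertex besides the logarithmic term: \<open>r\<close> for the parts, one for the
    exceptional set, \<open>log 2 r\<close> for the sparse part, and one more that produces the negative term \<open>- n\<close>.\<close>
  define c where "c = real r + 2 + log 2 (real r)"
  obtain s where s: "s \<ge> 1" and sbig: "c + real t * log 2 (real s + 1) \<le> (\<epsilon> * r) * real s"
    using exists_large_part_size[of "\<epsilon> * r" c t] assms(1) r by auto
  obtain C' where C': "\<And>V :: 'a set. finite V \<Longrightarrow> real (card (multipartite_free V r s))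
           \<le> 2 powr ((real (k - 1) / real k + \<epsilon>) * (real (card V))\<^sup>2 / 2 + C')"
    using Suc.IH[OF s] unfolding r_def by blast
  define q where "q = r * s"
  define a where "a = real k / real r"
  have "a * real q = (a * real r) * real s" by (simp only: q_def of_nat_mult mult.assoc)
  also have "a * real r = real (r - 1)" by (simp add: a_def r_def)
  finally have aq: "a * real q = real ((r - 1) * s)" by simp
  have a0: "a \<ge> 0" by (simp add: a_def)
  \<comment> \<open>All terms of the recursion that do not grow with the number of vertices; the final 1 is
    the bit lost when the two summands of the recursion are added.\<close>
  define D where "D = (real q)\<^sup>2 + real q * real (t * 2 ^ q) + (a + \<epsilon>) * (real q)\<^sup>2 / 2 + 1"
  define N where "N = nat \<lceil>D\<rceil>"
  define C where "C = max (C' + 1) ((real N)\<^sup>2)"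
  have "real (card (multipartite_free V (Suc r) t)) \<le> 2 powr ((a + \<epsilon>) * (real (card V))\<^sup>2 / 2 + C)"
    if "finite V" for V :: "'a set"
    using that
  proof (induction V rule: finite_psubset_induct)
    case (psubset V)
    define n where "n = card V"
    define e where "e = (a + \<epsilon>) * (real n)\<^sup>2 / 2 + C"
    show ?case
    proof (cases "n < N")
      case True
      have "real (card (multipartite_free V (Suc r) t)) \<le> 2 ^ (card V)\<^sup>2"
        using of_nat_mono[OF card_multipartite_free_le[OF psubset(1)], where ?'a=real] by simp
      also have "\<dots> = 2 powr (real n)\<^sup>2" by (simp add: n_def flip: powr_realpow)
      also have "\<dots> \<le> 2 powr e"
      proof (intro powr_mono)
        have "(real n)\<^sup>2 \<le> (real N)\<^sup>2" using True by (intro power_mono) auto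
        also have "\<dots> \<le> C" by (simp add: C_def)
        also have "\<dots> \<le> e" using a0 assms(1) by (simp add: e_def)
        finally show "(real n)\<^sup>2 \<le> e" .
      qed auto
      finally show ?thesis by (simp add: e_def n_def)
    next
      case False
      then have nD: "real n \<ge> D" by (simp add: N_def) linarith
      define K where "K = 2 powr ((a + \<epsilon>) * (real n - real q)\<^sup>2 / 2 + C)"
      have "real (card (multipartite_free V (Suc r) t)) \<le> real (card (multipartite_free V r s)) +
         2 ^ (r * card V) * (2 ^ (r * s)\<^sup>2 * (2 ^ card V * ((2 ^ (r * s)) ^ (t * 2 ^ (r * s)) *
        (real r * ((real s + 1) ^ t * 2 ^ ((r - 1) * s))) ^ card V)) * K)"
      proof (rule card_multipartite_free_Suc_le[OF psubset(1) r s t])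
        fix W assume W: "W \<subset> V" "card W = card V - r * s" "r * s \<le> card V"
        then have "real (card W) = real n - real q" by (simp add: n_def q_def)
        then show "real (card (multipartite_free W (Suc r) t)) \<le> K"
          using psubset.IH[OF W(1)] by (simp add: K_def)
      qed (simp add: K_def)
      also have "2 ^ (r * card V) * (2 ^ (r * s)\<^sup>2 * (2 ^ card V * ((2 ^ (r * s)) ^ (t * 2 ^ (r * s)) *
        (real r * ((real s + 1) ^ t * 2 ^ ((r - 1) * s))) ^ card V)) * K)
        = 2 powr (real (r * n) + (real (q\<^sup>2) + (real n + (real q * real (t * 2 ^ q)
          + (log 2 r + (log 2 (real s + 1) * t + real ((r - 1) * s))) * real n))
          + ((a + \<epsilon>) * (real n - real q)\<^sup>2 / 2 + C)))"
      proof -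
        have 1: "(2::real) ^ m = 2 powr (real m)" for m by (simp add: powr_realpow)
        have 2: "(2 powr x) ^ m = (2::real) powr (x * real m)" for x m
          by (simp add: powr_powr flip: powr_realpow)
        have 3: "real r = 2 powr (log 2 r)" "real s + 1 = 2 powr (log 2 (real s + 1))"
          using r s by simp_all
        have 4: "(real r * ((real s + 1) ^ t * 2 ^ ((r - 1) * s))) ^ n
          = 2 powr ((log 2 r + (log 2 (real s + 1) * t + real ((r - 1) * s))) * real n)"
          by (subst 3(1), subst 3(2)) (simp only: 1 2 powr_add[symmetric])
        show ?thesis
          unfolding K_def n_def[symmetric] q_def[symmetric] 4
          by (simp only: 1 2 powr_add[symmetric])
      qed
      also have "\<dots> \<le> 2 powr (e - 1)"
      proof (intro powr_mono)
        have "(c + real t * log 2 (real s + 1)) * real n \<le> (\<epsilon> * real q) * real n"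
          using sbig by (intro mult_right_mono) (auto simp: q_def mult.assoc)
        \<comment> \<open>With \<open>X = a * q\<close> the main terms cancel: removing \<open>q\<close> vertices lowers
          the quadratic exponent by \<open>a * q * n\<close>, exactly what the traces of the outside vertices need.\<close>
        moreover define X where "X = real ((r - 1) * s)"
        moreover have "X * real n = a * real q * real n" by (simp only: X_def aq)
        moreover have "real (r * n) + (real (q\<^sup>2) + (real n + (real q * real (t * 2 ^ q)
          + (log 2 r + (log 2 (real s + 1) * t + X)) * real n))
          + ((a + \<epsilon>) * (real n - real q)\<^sup>2 / 2 + C)) - (e - 1)
          = (c + real t * log 2 (real s + 1)) * real n - (\<epsilon> * real q) * real n
            + (X * real n - a * real q * real n) + (D - real n)"
          unfolding e_def D_def c_def
          by (simp add: algebra_simps power2_eq_square add_divide_distrib diff_divide_distrib)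
        ultimately show "real (r * n) + (real (q\<^sup>2) + (real n + (real q * real (t * 2 ^ q)
          + (log 2 r + (log 2 (real s + 1) * t + real ((r - 1) * s))) * real n))
          + ((a + \<epsilon>) * (real n - real q)\<^sup>2 / 2 + C)) \<le> e - 1"
          using nD unfolding X_def[symmetric] by linarith
      qed auto
      also have "real (card (multipartite_free V r s)) \<le> 2 powr (e - 1)"
      proof -
        have "real (k - 1) / real k \<le> a"
          by (cases k) (auto simp: a_def r_def divide_simps algebra_simps)
        then have "(real (k - 1) / real k + \<epsilon>) * (real n)\<^sup>2 / 2 + C' \<le> e - 1"
          unfolding e_def C_def by (intro add_mono mult_right_mono divide_right_mono diff_mono
            order_trans[OF _ eq_refl[OF add_diff_eq]]) auto
        then have "2 powr ((real (k - 1) / real k + \<epsilon>) * (real n)\<^sup>2 / 2 + C') \<le> 2 powr (e - 1)"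
          by (intro powr_mono) auto
        with C'[OF psubset(1)] show ?thesis unfolding n_def by (rule order_trans)
      qed
      also have "2 powr (e - 1) + 2 powr (e - 1) = 2 powr e" by (simp add: powr_diff)
      finally show ?thesis by (simp add: e_def n_def)
    qed
  qed
  then show ?case by (auto simp: a_def r_def intro!: exI[of _ C])
qed

section \<open>Turan graphs\<close>

text \<open>The edges of the balanced complete \<open>k\<close>-partite graph on \<open>{1..n}\<close> whose classes are the residue classes modulo \<open>k\<close>;
  injectivity on a two-element set says that its elements have different residues.\<close>

definition turan_edges :: "nat \<Rightarrow> nat \<Rightarrow> nat set set" where
  "turan_edges n k = {e \<in> all_edges {1..n}. inj_on (\<lambda>v. v mod k) e}"

lemma turan_edges_subset: "turan_edges n k \<subseteq> all_edges {1..n}"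
  by (auto simp: turan_edges_def)

lemma doubleton_in_turan_edges:
  "{u, v} \<in> turan_edges n k \<Longrightarrow> u mod k \<noteq> v mod k"
  by (auto simp: turan_edges_def all_edges_def card_insert_if inj_on_def split: if_splits)

lemma finite_turan_edges: "finite (turan_edges n k)"
  by (rule finite_subset[OF turan_edges_subset]) (simp add: finite_all_edges)

text \<open>A pair with larger element \<open>v\<close> inside a class has the form \<open>{v - j * k, v}\<close>, which leaves at most \<open>v div k\<close>
  choices of \<open>j\<close>.\<close>

lemma card_non_turan_edges_le:
  assumes "k \<ge> 1"
  shows "real (card (all_edges {1..n} - turan_edges n k)) \<le> real n * (real n + 1) / (2 * real k)"
proof -
  let ?I = "SIGMA v:{1..n}. {1..v div k}"
  have "all_edges {1..n} - turan_edges n k \<subseteq> (\<lambda>(v, j). {v - j * k, v}) ` ?I"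
  proof
    fix e assume e: "e \<in> all_edges {1..n} - turan_edges n k"
    then obtain u v where uv: "e = {u, v}" "u < v" "u \<in> {1..n}" "v \<in> {1..n}"
    proof -
      obtain a b where "e = {a, b}" "a \<noteq> b" using e by (auto simp: all_edges_def card_2_iff)
      then show thesis using that[of a b] that[of b a] e
        by (cases "a < b") (auto simp: all_edges_def insert_commute)
    qed
    then have "v mod k = u mod k"
      using e by (auto simp: turan_edges_def inj_on_def)
    then have "k dvd v - u" using uv by (simp add: mod_eq_dvd_iff_nat)
    then obtain j where j: "v - u = k * j" by blast
    have "j \<ge> 1" using j uv by (cases j) auto
    moreover have "j \<le> v div k"
      using j assms by (metis diff_le_self div_le_mono nonzero_mult_div_cancel_left not_one_le_zero)
    moreover have "u = v - j * k" using j uv by (simp add: mult.commute)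
    ultimately show "e \<in> (\<lambda>(v, j). {v - j * k, v}) ` ?I"
      using uv by (intro image_eqI[of _ _ "(v, j)"]) auto
  qed
  then have "card (all_edges {1..n} - turan_edges n k) \<le> card ?I"
    by (intro surj_card_le[OF finite_SigmaI]) auto
  also have "card ?I = (\<Sum>v=1..n. v div k)" by simp
  finally have "real (card (all_edges {1..n} - turan_edges n k)) \<le> (\<Sum>v=1..n. real (v div k))"
    by (metis of_nat_le_iff of_nat_sum)
  also have "\<dots> \<le> (\<Sum>v=1..n. real v / real k)"
    by (intro sum_mono of_nat_div_le_of_nat)
  also have "\<dots> = (\<Sum>v=1..n. real v) / real k" by (simp add: sum_divide_distrib)
  also have "(\<Sum>v=1..n. real v) = real n * (real n + 1) / 2"
    by (induction n) (auto simp: field_simps)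
  finally show ?thesis by simp
qed

lemma card_turan_edges_ge:
  assumes "k \<ge> 1"
  shows "real (card (turan_edges n k))
    \<ge> real n * (real n - 1) / 2 - real n * (real n + 1) / (2 * real k)"
proof -
  have "card (all_edges {1..n}) = card (turan_edges n k) + card (all_edges {1..n} - turan_edges n k)"
    using turan_edges_subset[of n k] by (simp add: card_Diff_subset card_mono finite_all_edges finite_turan_edges)
  moreover have "real (card (all_edges {1..n})) = real n * (real n - 1) / 2"
    by (cases n) (auto simp: card_all_edges choose_two real_of_nat_div field_simps)
  ultimately show ?thesis using card_non_turan_edges_le[OF assms, of n] by linarith
qed

section \<open>Chromatic number and induced copies\<close>

lemma proper_colouring_chromatic_number:
  assumes "finite_simple_graph L"
  shows "\<exists>c. proper_colouring L (chromatic_number L) c"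
proof -
  obtain c :: "'a \<Rightarrow> nat" where c: "bij_betw c (verts L) {0..<card (verts L)}"
    using assms ex_bij_betw_finite_nat by (auto simp: finite_simple_graph_def)
  have "proper_colouring L (card (verts L)) c"
    unfolding proper_colouring_def
  proof (intro conjI ballI impI)
    fix v assume "v \<in> verts L" then show "c v < card (verts L)" using c by (auto dest: bij_betwE)
  next
    fix u v assume *: "u \<in> verts L" "v \<in> verts L" "{u, v} \<in> edges L"
    then have "u \<noteq> v" using assms by (auto simp: finite_simple_graph_def all_edges_def)
    then show "c u \<noteq> c v" using c * by (auto simp: bij_betw_def inj_on_def)
  qed
  then have "\<exists>k c. proper_colouring L k c" by blast
  then show ?thesis unfolding chromatic_number_def by (rule LeastI_ex)
qed

lemma chromatic_number_le: "proper_colouring L k c \<Longrightarrow> chromatic_number L \<le> k"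
  unfolding chromatic_number_def by (rule Least_le) blast

lemma ex_edge:
  assumes "finite_simple_graph L" "edges L \<noteq> {}"
  obtains u v where "{u, v} \<in> edges L" "u \<in> verts L" "v \<in> verts L" "u \<noteq> v"
proof -
  obtain e where "e \<in> edges L" using assms by blast
  moreover then have "e \<in> all_edges (verts L)" using assms by (auto simp: finite_simple_graph_def)
  ultimately show thesis using that by (auto simp: all_edges_def card_2_iff)
qed

lemma chromatic_number_ge_2:
  assumes "finite_simple_graph L" "edges L \<noteq> {}"
  shows "chromatic_number L \<ge> 2"
proof -
  obtain c where c: "proper_colouring L (chromatic_number L) c"
    using proper_colouring_chromatic_number[OF assms(1)] by blast
  obtain u v where "{u, v} \<in> edges L" "u \<in> verts L" "v \<in> verts L" using ex_edge[OF assms] .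
  then have "c u \<noteq> c v" "c u < chromatic_number L" "c v < chromatic_number L"
    using c by (auto simp: proper_colouring_def)
  then show ?thesis by linarith
qed

lemma proper_colouring_if_contains_induced:
  assumes "contains_induced (V, E) L" "proper_colouring (V, E) k c"
  shows "\<exists>c'. proper_colouring L k c'"
proof -
  obtain W where W: "W \<subseteq> V" and "graph_isomorphic (induced_subgraph (V, E) W) L"
    using assms(1) unfolding contains_induced_def fst_conv by blast
  then obtain f where f: "bij_betw f W (verts L)"
    and iso: "\<forall>u\<in>W. \<forall>v\<in>W. {u, v} \<in> {e \<in> E. e \<subseteq> W} \<longleftrightarrow> {f u, f v} \<in> edges L"
    unfolding graph_isomorphic_def induced_subgraph_def fst_conv snd_conv by (elim exE conjE) (rule that)
  let ?g = "inv_into W f"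
  have g: "?g x \<in> W" "f (?g x) = x" if "x \<in> verts L" for x
    using f that by (auto simp: bij_betw_def inv_into_into f_inv_into_f)
  have "proper_colouring L k (c \<circ> ?g)"
    unfolding proper_colouring_def
  proof (intro conjI ballI impI)
    fix v assume "v \<in> verts L"
    then show "(c \<circ> ?g) v < k" using g(1)[of v] W assms(2) by (auto simp: proper_colouring_def)
  next
    fix u v assume *: "u \<in> verts L" "v \<in> verts L" "{u, v} \<in> edges L"
    then have "{?g u, ?g v} \<in> E" using iso g by simp
    then show "(c \<circ> ?g) u \<noteq> (c \<circ> ?g) v"
      using g(1)[of u] g(1)[of v] * W assms(2) by (auto simp: proper_colouring_def)
  qed
  then show ?thesis by blast
qed

lemma contains_induced_if_embedding:
  assumes inj: "inj_on \<phi> (verts L)" and "\<phi> ` verts L \<subseteq> V"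
    and iff: "\<And>u v. u \<in> verts L \<Longrightarrow> v \<in> verts L \<Longrightarrow> {\<phi> u, \<phi> v} \<in> E \<longleftrightarrow> {u, v} \<in> edges L"
  shows "contains_induced (V, E) L"
proof -
  let ?f = "inv_into (verts L) \<phi>"
  have "bij_betw ?f (\<phi> ` verts L) (verts L)"
    using inj by (simp add: bij_betw_inv_into inj_on_imp_bij_betw)
  moreover have "{x, y} \<in> {e \<in> E. e \<subseteq> \<phi> ` verts L} \<longleftrightarrow> {?f x, ?f y} \<in> edges L"
    if xy: "x \<in> \<phi> ` verts L" "y \<in> \<phi> ` verts L" for x y
  proof -
    obtain u v where uv: "u \<in> verts L" "v \<in> verts L" "x = \<phi> u" "y = \<phi> v" using xy by blast
    then show ?thesis using iff[OF uv(1,2)] inj by simp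
  qed
  ultimately have "graph_isomorphic (induced_subgraph (V, E) (\<phi> ` verts L)) L"
    unfolding graph_isomorphic_def induced_subgraph_def fst_conv snd_conv
    by (intro exI[of _ ?f]) simp
  then show ?thesis using assms(2) unfolding contains_induced_def fst_conv by blast
qed

section \<open>Upper bound for codes\<close>

lemma finite_labelled_graphs: "finite (labelled_graphs n)"
proof (rule finite_subset)
  show "labelled_graphs n \<subseteq> {{1..n}} \<times> Pow (all_edges {1..n})"
    by (auto simp: labelled_graphs_def)
qed (simp add: finite_all_edges)

lemma finite_code_sizes: "finite {card F | F. ind_code L n F}"
proof (rule finite_subset)
  show "{card F | F. ind_code L n F} \<subseteq> card ` Pow (labelled_graphs n)"
    by (auto simp: ind_code_def)
qed (simp add: finite_labelled_graphs)

lemma card_le_M_ind: "ind_code L n F \<Longrightarrow> card F \<le> M_ind L n"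
  unfolding M_ind_def by (intro Max_ge finite_code_sizes) blast

lemma M_ind_le:
  assumes "\<And>F. ind_code L n F \<Longrightarrow> card F \<le> b"
  shows "M_ind L n \<le> b"
proof -
  have "ind_code L n {}" by (simp add: ind_code_def)
  then have "{card F | F. ind_code L n F} \<noteq> {}" by blast
  then show ?thesis unfolding M_ind_def using finite_code_sizes[of L n] assms
    by (subst Max_le_iff) auto
qed

text \<open>If two members agree outside the Turan graph with fewer classes than the chromatic number, the
  residues properly colour their sum and therefore any induced copy of \<open>L\<close> in it.\<close>

lemma M_ind_upper_bound:
  assumes "k \<ge> 1" "k < chromatic_number L"
  shows "M_ind L n \<le> 2 ^ card (all_edges {1..n} - turan_edges n k)"
proof (rule M_ind_le)
  fix F assume F: "ind_code L n F"
  let ?D = "all_edges {1..n} - turan_edges n k"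
  have "card F \<le> card (Pow ?D)"
  proof (rule card_inj_on_le[of "\<lambda>G. edges G \<inter> ?D"])
    show "inj_on (\<lambda>G. edges G \<inter> ?D) F"
    proof (rule inj_onI, rule ccontr)
      fix G G' assume G: "G \<in> F" "G' \<in> F" "edges G \<inter> ?D = edges G' \<inter> ?D" "G \<noteq> G'"
      define E where "E = sym_diff (edges G) (edges G')"
      have l: "G \<in> labelled_graphs n" "G' \<in> labelled_graphs n"
        and ind: "contains_induced (graph_sum G G') L"
        using F G unfolding ind_code_def by auto
      then have "E \<subseteq> turan_edges n k"
        using G(3) unfolding E_def labelled_graphs_def by blast
      then have "proper_colouring ({1..n}, E) k (\<lambda>v. v mod k)"
        using assms(1) doubleton_in_turan_edges unfolding proper_colouring_def by fastforce
      moreover have "contains_induced ({1..n}, E) L"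
        using ind l by (simp add: graph_sum_def E_def labelled_graphs_def)
      ultimately obtain c where "proper_colouring L k c"
        using proper_colouring_if_contains_induced by blast
      then show False using chromatic_number_le assms(2) by fastforce
    qed
  qed (auto simp: finite_all_edges)
  then show "card F \<le> 2 ^ card ?D" by (simp add: card_Pow finite_all_edges)
qed

section \<open>Lower bound for codes\<close>

text \<open>The greedy bound: if a code \<open>F\<close> is maximal, then every subset of \<open>T\<close> differs from
  some member by an element of \<open>B\<close>, so the translates of \<open>B\<close> by the members cover the power set.\<close>

lemma Gilbert_Varshamov:
  assumes fT: "finite T" and BT: "B \<subseteq> Pow T" and B0: "{} \<in> B"
  shows "\<exists>F\<subseteq>Pow T. (\<forall>X\<in>F. \<forall>Y\<in>F. X \<noteq> Y \<longrightarrow> sym_diff X Y \<notin> B) \<and> 2 ^ card T \<le> card F * card B"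
proof -
  define ok where "ok F \<longleftrightarrow> F \<subseteq> Pow T \<and> (\<forall>X\<in>F. \<forall>Y\<in>F. X \<noteq> Y \<longrightarrow> sym_diff X Y \<notin> B)" for F
  have "finite {F. ok F}"
    using fT by (intro finite_subset[OF _ finite_Pow_iff[THEN iffD2, of "Pow T"]]) (auto simp: ok_def)
  moreover have "{} \<in> {F. ok F}" by (simp add: ok_def)
  ultimately have "\<exists>F\<in>{F. ok F}. {} \<subseteq> F \<and> (\<forall>F'\<in>{F. ok F}. F \<subseteq> F' \<longrightarrow> F = F')"
    by (rule finite_has_maximal2)
  then obtain F where F: "ok F" and max: "\<And>F'. ok F' \<Longrightarrow> F \<subseteq> F' \<Longrightarrow> F = F'"
    by (simp only: mem_Collect_eq Bex_def Ball_def) (elim exE conjE, rule that, assumption, blast)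
  have FT: "F \<subseteq> Pow T" and FB: "\<And>X Y. X \<in> F \<Longrightarrow> Y \<in> F \<Longrightarrow> X \<noteq> Y \<Longrightarrow> sym_diff X Y \<notin> B"
    using F unfolding ok_def by blast+
  have cover: "\<exists>Y\<in>F. sym_diff Y X \<in> B" if X: "X \<subseteq> T" for X
  proof (cases "X \<in> F")
    case True
    then show ?thesis using B0 by (intro bexI[of _ X]) auto
  next
    case False
    then have "\<not> ok (insert X F)" using max[of "insert X F"] by blast
    then obtain Y Z where YZ: "Y \<in> insert X F" "Z \<in> insert X F" "Y \<noteq> Z" "sym_diff Y Z \<in> B"
      using FT X unfolding ok_def by blast
    have comm: "sym_diff Y Z = sym_diff Z Y" by blast
    show ?thesis
    proof (cases "Y = X")
      case True
      then have "Z \<in> F" using YZ by blast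
      then show ?thesis using YZ comm True by auto
    next
      case False
      then have "Y \<in> F" using YZ by blast
      then have "Z = X" using FB[of Y Z] YZ by blast
      then show ?thesis using YZ \<open>Y \<in> F\<close> by auto
    qed
  qed
  have fin: "finite F" "finite B" using FT BT fT by (auto intro: finite_subset[of _ "Pow T"])
  have "Pow T \<subseteq> (\<lambda>(Y, Z). sym_diff Y Z) ` (F \<times> B)"
  proof
    fix X assume "X \<in> Pow T"
    then obtain Y where Y: "Y \<in> F" "sym_diff Y X \<in> B" using cover by blast
    moreover have "X = sym_diff Y (sym_diff Y X)" by blast
    ultimately show "X \<in> (\<lambda>(Y, Z). sym_diff Y Z) ` (F \<times> B)"
      by (intro image_eqI[of _ _ "(Y, sym_diff Y X)"]) auto
  qed
  then have "card (Pow T) \<le> card (F \<times> B)"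
    by (rule surj_card_le[OF finite_cartesian_product[OF fin]])
  then have "2 ^ card T \<le> card F * card B" using fT by (simp add: card_Pow card_cartesian_product)
  then show ?thesis using FT FB by (intro exI[of _ F]) simp
qed

lemma large_fibre:
  assumes "finite A" "card A = k * t" "k \<ge> 1" "\<And>x. x \<in> A \<Longrightarrow> f x < k"
  shows "\<exists>B\<subseteq>A. card B = t \<and> (\<forall>x\<in>B. \<forall>y\<in>B. f x = f y)"
proof -
  have "f \<in> A \<rightarrow> {..<k}" using assms(4) by auto
  moreover have "{..<k} \<noteq> {}" using assms(3) by (simp add: lessThan_empty_iff)
  ultimately have "\<exists>y\<in>{..<k}. card A \<le> card (f -` {y} \<inter> A) * card {..<k}"
    using assms(1) by (intro pigeonhole_card) auto
  then
  obtain y where "k * t \<le> card (f -` {y} \<inter> A) * k" using assms(2) by auto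
  moreover have "f -` {y} \<inter> A = {x\<in>A. f x = y}" by auto
  ultimately have y: "t \<le> card {x\<in>A. f x = y}" using assms(3) by (simp add: mult.commute)
  then obtain B where "B \<subseteq> {x\<in>A. f x = y}" "card B = t" by (rule obtain_subset_with_card_n)
  then show ?thesis by (intro exI[of _ B]) auto
qed

text \<open>Parts \<open>k\<close> times larger than \<open>L\<close> contain, by the pigeonhole principle, \<open>card (verts L)\<close> vertices of one residue
  class. Colour class \<open>i\<close> of \<open>L\<close> is placed in that subset of part \<open>i\<close>, where graphs of \<open>B\<close> have no edges;
  between different parts, shattering makes it possible to prescribe the edges of \<open>L\<close> and nothing else.\<close>

lemma contains_induced_if_shatters:
  fixes L :: "'a graph"
  assumes L: "finite_simple_graph L" "verts L \<noteq> {}" and c: "proper_colouring L r c"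
    and k: "k \<ge> 1" and B: "B \<subseteq> Pow (turan_edges n k)" and S: "S \<subseteq> turan_edges n k" "shatters B S"
    and at: "multipartite_at S r (k * card (verts L)) A" and AV: "\<And>i. i < r \<Longrightarrow> A i \<subseteq> {1..n}"
  shows "\<exists>E\<in>B. contains_induced ({1..n}, E) L"
proof -
  let ?V = "verts L"
  define t where "t = card ?V"
  have fL: "finite ?V" using L by (simp add: finite_simple_graph_def)
  have t: "t \<ge> 1" using fL L by (simp add: t_def Suc_le_eq card_gt_0_iff)
  have Sall: "S \<subseteq> all_edges {1..n}" using S turan_edges_subset by blast
  have kt: "k * card ?V \<ge> 1" using k t by (simp add: t_def)
  note parts = multipartite_at_parts[OF at Sall kt]
  have "\<exists>h. \<forall>i<r. h i ` ?V \<subseteq> A i \<and> inj_on (h i) ?V \<and> (\<forall>x\<in>?V. \<forall>y\<in>?V. h i x mod k = h i y mod k)"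
  proof -
    have "\<exists>h. h ` ?V \<subseteq> A i \<and> inj_on h ?V \<and> (\<forall>x\<in>?V. \<forall>y\<in>?V. h x mod k = h y mod k)" if "i < r" for i
    proof -
      have "card (A i) = k * t" using at that by (simp add: multipartite_at_def t_def)
      then have "\<exists>A'\<subseteq>A i. card A' = t \<and> (\<forall>x\<in>A'. \<forall>y\<in>A'. x mod k = y mod k)"
        using k by (intro large_fibre[OF parts(1)[OF that] _ k]) auto
      then obtain A' where A': "A' \<subseteq> A i" "card A' = t" "\<forall>x\<in>A'. \<forall>y\<in>A'. x mod k = y mod k"
        by blast
      moreover have "finite A'" using A' t by (intro card_ge_0_finite) simp
      ultimately obtain h where "bij_betw h ?V A'"
        using fL t_def finite_same_card_bij by metis
      then show ?thesis using A' by (intro exI[of _ h]) (auto simp: bij_betw_def)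
    qed
    then show ?thesis by metis
  qed
  then obtain h where h: "\<And>i. i < r \<Longrightarrow> h i ` ?V \<subseteq> A i" "\<And>i. i < r \<Longrightarrow> inj_on (h i) ?V"
    "\<And>i x y. i < r \<Longrightarrow> x \<in> ?V \<Longrightarrow> y \<in> ?V \<Longrightarrow> h i x mod k = h i y mod k" by metis
  define \<phi> where "\<phi> = (\<lambda>v. h (c v) v)"
  have cr: "c v < r" if "v \<in> ?V" for v using c that by (simp add: proper_colouring_def)
  have \<phi>A: "\<phi> v \<in> A (c v)" if "v \<in> ?V" for v using h(1)[OF cr[OF that]] that by (auto simp: \<phi>_def)
  have inj: "inj_on \<phi> ?V"
  proof (rule inj_onI)
    fix u v assume *: "u \<in> ?V" "v \<in> ?V" "\<phi> u = \<phi> v"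
    have "c u = c v"
    proof (rule ccontr)
      assume "c u \<noteq> c v"
      then have "A (c u) \<inter> A (c v) = {}" using parts(2) cr * by blast
      then show False using \<phi>A[of u] \<phi>A[of v] * by auto
    qed
    then show "u = v" using h(2)[OF cr[OF *(1)]] * by (auto simp: \<phi>_def inj_on_def)
  qed
  define T where "T = (\<lambda>e. \<phi> ` e) ` edges L"
  have edge: "e \<subseteq> ?V" "card e = 2" if "e \<in> edges L" for e
    using that L by (auto simp: finite_simple_graph_def all_edges_def)
  have cross: "{\<phi> u, \<phi> v} \<in> S" if "u \<in> ?V" "v \<in> ?V" "c u \<noteq> c v" for u v
    using at cr[OF that(1)] cr[OF that(2)] \<phi>A[OF that(1)] \<phi>A[OF that(2)] that(3)
    unfolding multipartite_at_def by blast
  have "T \<subseteq> S"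
  proof
    fix x assume "x \<in> T"
    then obtain e where e: "e \<in> edges L" "x = \<phi> ` e" by (auto simp: T_def)
    then obtain u v where uv: "e = {u, v}" using edge[OF e(1)] by (auto simp: card_2_iff)
    then have "u \<in> ?V" "v \<in> ?V" using edge[OF e(1)] by auto
    moreover then have "c u \<noteq> c v" using c e uv by (auto simp: proper_colouring_def)
    ultimately show "x \<in> S" using cross e uv by simp
  qed
  then obtain E where E: "E \<in> B" "E \<inter> S = T" using S(2) unfolding shatters_def by blast
  have "contains_induced ({1..n}, E) L"
  proof (rule contains_induced_if_embedding[OF inj])
    show "\<phi> ` ?V \<subseteq> {1..n}" using \<phi>A AV cr by blast
    fix u v assume uv: "u \<in> ?V" "v \<in> ?V"
    show "{\<phi> u, \<phi> v} \<in> E \<longleftrightarrow> {u, v} \<in> edges L"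
    proof
      assume "{u, v} \<in> edges L"
      then have "\<phi> ` {u, v} \<in> T" unfolding T_def by blast
      then show "{\<phi> u, \<phi> v} \<in> E" using E by auto
    next
      assume uvE: "{\<phi> u, \<phi> v} \<in> E"
      then have "\<phi> u mod k \<noteq> \<phi> v mod k" using E B doubleton_in_turan_edges by blast
      then have "c u \<noteq> c v" using h(3)[OF cr[OF uv(1)] uv] by (auto simp: \<phi>_def)
      then have "{\<phi> u, \<phi> v} \<in> T" using cross uv uvE E by blast
      then obtain e where e: "e \<in> edges L" "\<phi> ` {u, v} = \<phi> ` e" by (auto simp: T_def)
      then have "{u, v} = e" using inj_on_image_eq_iff[OF inj, of "{u, v}" e] edge[OF e(1)] uv by auto
      then show "{u, v} \<in> edges L" using e by simp
    qed
  qed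
  then show ?thesis using E by blast
qed

definition induced_free_subgraphs :: "'b graph \<Rightarrow> nat \<Rightarrow> nat set set \<Rightarrow> nat set set set" where
  "induced_free_subgraphs L n T = {E. E \<subseteq> T \<and> \<not> contains_induced ({1..n}, E) L}"

lemma card_induced_free_subgraphs_le:
  assumes L: "finite_simple_graph L" "verts L \<noteq> {}" and k: "k \<ge> 1"
  shows "card (induced_free_subgraphs L n (turan_edges n k))
    \<le> card (multipartite_free {1..n} (chromatic_number L) (k * card (verts L)))"
proof -
  let ?B = "induced_free_subgraphs L n (turan_edges n k)"
  obtain c where c: "proper_colouring L (chromatic_number L) c"
    using proper_colouring_chromatic_number[OF L(1)] by blast
  have B: "?B \<subseteq> Pow (turan_edges n k)" by (auto simp: induced_free_subgraphs_def)
  have "card ?B \<le> card {S. S \<subseteq> turan_edges n k \<and> shatters ?B S}"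
    by (rule card_le_card_shattered[OF finite_turan_edges B])
  also have "\<dots> \<le> card (multipartite_free {1..n} (chromatic_number L) (k * card (verts L)))"
  proof (rule card_mono)
    show "{S. S \<subseteq> turan_edges n k \<and> shatters ?B S}
       \<subseteq> multipartite_free {1..n} (chromatic_number L) (k * card (verts L))"
    proof clarify
      fix S assume S: "S \<subseteq> turan_edges n k" "shatters ?B S"
      have "\<not> (\<exists>A. (\<forall>i<chromatic_number L. A i \<subseteq> {1..n})
        \<and> multipartite_at S (chromatic_number L) (k * card (verts L)) A)"
      proof
        assume "\<exists>A. (\<forall>i<chromatic_number L. A i \<subseteq> {1..n})
          \<and> multipartite_at S (chromatic_number L) (k * card (verts L)) A"
        then obtain A where A: "\<And>i. i < chromatic_number L \<Longrightarrow> A i \<subseteq> {1..n}"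
          "multipartite_at S (chromatic_number L) (k * card (verts L)) A" by blast
        have "\<exists>E\<in>?B. contains_induced ({1..n}, E) L"
          by (rule contains_induced_if_shatters[OF L c k B S A(2,1)])
        then show False by (auto simp: induced_free_subgraphs_def)
      qed
      moreover have "S \<subseteq> all_edges {1..n}" using S turan_edges_subset by blast
      ultimately show "S \<in> multipartite_free {1..n} (chromatic_number L) (k * card (verts L))"
        unfolding multipartite_free_def by blast
    qed
  qed (simp add: finite_multipartite_free)
  finally show ?thesis .
qed

text \<open>Combines the greedy bound in the Turan graph with the bound for the number of forbidden differences. The
  empty graph is a forbidden difference because \<open>L\<close> has an edge.\<close>

lemma M_ind_lower_bound:
  assumes L: "finite_simple_graph L" "edges L \<noteq> {}" and k: "k \<ge> 1"
  shows "2 ^ card (turan_edges n k)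
    \<le> M_ind L n * card (multipartite_free {1..n} (chromatic_number L) (k * card (verts L)))"
proof -
  let ?T = "turan_edges n k"
  let ?B = "induced_free_subgraphs L n ?T"
  obtain u v where uv: "{u, v} \<in> edges L" "u \<in> verts L" "v \<in> verts L" using ex_edge[OF L] .
  have "\<not> contains_induced ({1..n}, {}) L"
  proof
    assume "contains_induced ({1..n}, {}) L"
    moreover have "proper_colouring ({1..n}, {}) 1 (\<lambda>_. 0)" by (simp add: proper_colouring_def)
    ultimately obtain c where "proper_colouring L 1 c"
      using proper_colouring_if_contains_induced by blast
    then show False using chromatic_number_le chromatic_number_ge_2[OF L] by fastforce
  qed
  then have B0: "{} \<in> ?B" by (simp add: induced_free_subgraphs_def)
  have BT: "?B \<subseteq> Pow ?T" by (auto simp: induced_free_subgraphs_def)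
  obtain F where F: "F \<subseteq> Pow ?T" "\<forall>X\<in>F. \<forall>Y\<in>F. X \<noteq> Y \<longrightarrow> sym_diff X Y \<notin> ?B"
    and large: "2 ^ card ?T \<le> card F * card ?B"
    using Gilbert_Varshamov[OF finite_turan_edges BT B0] by (elim exE conjE) (rule that)
  let ?G = "\<lambda>E. ({1..n}, E)"
  have "ind_code L n (?G ` F)"
    unfolding ind_code_def
  proof (intro conjI ballI impI)
    have "E \<subseteq> all_edges {1..n}" if "E \<in> F" for E
      using F(1) turan_edges_subset that by blast
    then show "?G ` F \<subseteq> labelled_graphs n"
      by (simp add: labelled_graphs_def image_subset_iff)
    fix G G' assume "G \<in> ?G ` F" "G' \<in> ?G ` F" "G \<noteq> G'"
    then obtain X Y where XY: "G = ?G X" "G' = ?G Y" "X \<in> F" "Y \<in> F" "X \<noteq> Y" by blast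
    have "sym_diff X Y \<notin> ?B" using F(2) XY(3-5) by simp
    moreover have "sym_diff X Y \<subseteq> ?T" using F(1) XY(3,4) by blast
    ultimately show "contains_induced (graph_sum G G') L"
      using XY by (simp add: induced_free_subgraphs_def graph_sum_def)
  qed
  then have "card (?G ` F) \<le> M_ind L n" by (rule card_le_M_ind)
  then have "card F \<le> M_ind L n" by (simp add: card_image inj_on_def)
  moreover have "card ?B \<le> card (multipartite_free {1..n} (chromatic_number L) (k * card (verts L)))"
    using uv by (intro card_induced_free_subgraphs_le L k) auto
  ultimately show ?thesis using large by (meson le_trans mult_le_mono)
qed

section \<open>The rate\<close>

text \<open>The bound tends to \<open>1 / k\<close>, so the best choice of \<open>k\<close> is the chromatic number minus 1.\<close>

lemma ind_rate_le:
  assumes L: "finite_simple_graph L" "edges L \<noteq> {}" and n: "n \<ge> 2"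
    and k: "k \<ge> 1" "k < chromatic_number L"
  shows "ind_rate L n \<le> (1 / real k) * ((real n + 1) / (real n - 1))"
proof -
  let ?D = "all_edges {1..n} - turan_edges n k"
  have pos: "M_ind L n > 0"
    using M_ind_lower_bound[OF L k(1), of n] by (cases "M_ind L n") auto
  have "real (M_ind L n) \<le> 2 ^ card ?D"
    using of_nat_mono[OF M_ind_upper_bound[OF k, of n], where ?'a = real] by simp
  then have "log 2 (real (M_ind L n)) \<le> log 2 (2 ^ card ?D)"
    using pos by (intro log_mono) auto
  also have "\<dots> = real (card ?D)" by simp
  also have "\<dots> \<le> real n * (real n + 1) / (2 * real k)"
    by (rule card_non_turan_edges_le[OF k(1)])
  finally have "ind_rate L n \<le> 2 / (real n * (real n - 1)) * (real n * (real n + 1) / (2 * real k))"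
    unfolding ind_rate_def using n by (intro mult_left_mono) auto
  also have "\<dots> = (1 / real k) * ((real n + 1) / (real n - 1))"
    using n k by (simp add: divide_simps) (simp add: algebra_simps)
  finally show ?thesis .
qed

text \<open>The right-hand side tends to \<open>1 / k - 1 / m - \<epsilon>\<close>; the number of classes \<open>m\<close> and the error \<open>\<epsilon>\<close> are free.\<close>

lemma ind_rate_ge:
  assumes L: "finite_simple_graph L" "edges L \<noteq> {}" and m: "m \<ge> 1" and \<epsilon>: "\<epsilon> > 0"
    and k: "chromatic_number L = Suc k"
  shows "\<exists>C. \<forall>n\<ge>2. 1 - (1 / real m) * ((real n + 1) / (real n - 1))
      - (real (k - 1) / real k + \<epsilon>) * (real n / (real n - 1)) - 2 * C * (1 / (real n * (real n - 1)))
      \<le> ind_rate L n"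
proof -
  let ?t = "m * card (verts L)"
  obtain u v where "u \<in> verts L" using ex_edge[OF L] .
  moreover have "finite (verts L)" using L by (simp add: finite_simple_graph_def)
  ultimately have "card (verts L) \<ge> 1" by (auto simp: Suc_le_eq card_gt_0_iff)
  then have t: "?t \<ge> 1" using m by simp
  define b where "b = real (k - 1) / real k + \<epsilon>"
  obtain C where C: "\<And>V :: nat set. finite V \<Longrightarrow> real (card (multipartite_free V (Suc k) ?t))
      \<le> 2 powr (b * (real (card V))\<^sup>2 / 2 + C)"
    using card_multipartite_free_le_powr[OF \<epsilon> t, of k] unfolding b_def by blast
  have "1 - (1 / real m) * ((real n + 1) / (real n - 1)) - b * (real n / (real n - 1))
      - 2 * C * (1 / (real n * (real n - 1))) \<le> ind_rate L n" if n: "n \<ge> 2" for n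
  proof -
    define x where "x = b * (real n)\<^sup>2 / 2 + C"
    define e where "e = real (card (turan_edges n m))"
    define M where "M = real (M_ind L n)"
    let ?N = "card (multipartite_free {1..n} (Suc k) ?t)"
    have "2 powr e = real (2 ^ card (turan_edges n m))" by (simp add: e_def powr_realpow)
    also have "\<dots> \<le> real (M_ind L n * ?N)"
      using M_ind_lower_bound[OF L m, of n] unfolding k by (rule of_nat_mono)
    also have "\<dots> \<le> M * 2 powr x"
      using C[of "{1..n}"] by (simp add: M_def x_def mult_left_mono)
    finally have le: "2 powr e \<le> M * 2 powr x" .
    then have M: "M > 0"
      using powr_gt_zero[of 2 e] by (smt (verit) zero_less_mult_pos2 powr_gt_zero)
    have "e = log 2 (2 powr e)" by simp
    also have "\<dots> \<le> log 2 (M * 2 powr x)" using le by (intro log_mono) auto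
    also have "\<dots> = log 2 M + x" using M by (simp add: log_mult)
    finally have "real n * (real n - 1) / 2 - real n * (real n + 1) / (2 * real m) - x \<le> log 2 M"
      using card_turan_edges_ge[OF m, of n] by (simp add: e_def)
    then have "2 / (real n * (real n - 1))
        * (real n * (real n - 1) / 2 - real n * (real n + 1) / (2 * real m) - x) \<le> ind_rate L n"
      unfolding ind_rate_def M_def using n by (intro mult_left_mono) auto
    moreover have "2 / (real n * (real n - 1))
        * (real n * (real n - 1) / 2 - real n * (real n + 1) / (2 * real m) - x)
      = 1 - (1 / real m) * ((real n + 1) / (real n - 1)) - b * (real n / (real n - 1))
        - 2 * C * (1 / (real n * (real n - 1)))"
    proof -
      define y where "y = real n - 1"
      have "y > 0" "real n > 0" "real m > 0" using n m by (auto simp: y_def)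
      then show ?thesis
        unfolding x_def y_def[symmetric] by (simp add: field_simps power2_eq_square)
    qed
    ultimately show ?thesis by simp
  qed
  then show ?thesis unfolding b_def by blast
qed

theorem theorem18:
  fixes L :: "'a graph"
  assumes "finite_simple_graph L"
    and "edges L \<noteq> {}"
  shows "convergent (ind_rate L) \<and> DC_ind L = 1 / (real (chromatic_number L) - 1)"
proof -
  define k where "k = chromatic_number L - 1"
  have k: "k \<ge> 1" "k < chromatic_number L" "chromatic_number L = Suc k"
    using chromatic_number_ge_2[OF assms] by (auto simp: k_def)
  have ratio: "(\<lambda>n. (real n + 1) / (real n - 1)) \<longlonglongrightarrow> 1" "(\<lambda>n. real n / (real n - 1)) \<longlonglongrightarrow> 1"
    "(\<lambda>n. 1 / (real n * (real n - 1))) \<longlonglongrightarrow> 0" by real_asymp+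
  have "ind_rate L \<longlonglongrightarrow> 1 / real k"
  proof (rule order_tendstoI)
    fix y assume y: "1 / real k < y"
    have "(\<lambda>n. (1 / real k) * ((real n + 1) / (real n - 1))) \<longlonglongrightarrow> (1 / real k) * 1"
      by (intro tendsto_intros ratio)
    then have "eventually (\<lambda>n. (1 / real k) * ((real n + 1) / (real n - 1)) < y) sequentially"
      using y by (intro order_tendstoD(2)) auto
    then show "eventually (\<lambda>n. ind_rate L n < y) sequentially"
      using eventually_ge_at_top[of 2]
    proof eventually_elim
      case (elim n)
      then show ?case using ind_rate_le[OF assms _ k(1,2), of n] by linarith
    qed
  next
    fix y assume y: "y < 1 / real k"
    define \<epsilon> where "\<epsilon> = (1 / real k - y) / 3"
    have \<epsilon>: "\<epsilon> > 0" using y by (simp add: \<epsilon>_def)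
    obtain j where j: "inverse (real (Suc j)) < \<epsilon>" using reals_Archimedean[OF \<epsilon>] by blast
    define m where "m = Suc j"
    have m: "m \<ge> 1" "1 / real m < \<epsilon>" using j by (auto simp: m_def inverse_eq_divide)
    let ?b = "real (k - 1) / real k + \<epsilon>"
    obtain C where C: "\<And>n. n \<ge> 2 \<Longrightarrow> 1 - (1 / real m) * ((real n + 1) / (real n - 1))
        - ?b * (real n / (real n - 1)) - 2 * C * (1 / (real n * (real n - 1))) \<le> ind_rate L n"
      using ind_rate_ge[OF assms m(1) \<epsilon> k(3)] by blast
    let ?l = "\<lambda>n. 1 - (1 / real m) * ((real n + 1) / (real n - 1))
        - ?b * (real n / (real n - 1)) - 2 * C * (1 / (real n * (real n - 1)))"
    have "?l \<longlonglongrightarrow> 1 - (1 / real m) * 1 - ?b * 1 - 2 * C * 0"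
      by (intro tendsto_intros ratio)
    moreover have "y < 1 - (1 / real m) * 1 - ?b * 1 - 2 * C * 0"
    proof -
      have "real (k - 1) / real k = 1 - 1 / real k" using k(1) by (simp add: of_nat_diff field_simps)
      then show ?thesis using m(2) \<epsilon> by (simp add: \<epsilon>_def field_simps)
    qed
    ultimately have "eventually (\<lambda>n. y < ?l n) sequentially" by (rule order_tendstoD(1))
    then show "eventually (\<lambda>n. y < ind_rate L n) sequentially"
      using eventually_ge_at_top[of 2]
    proof eventually_elim
      case (elim n)
      then show ?case using C[of n] by linarith
    qed
  qed
  then show ?thesis
    using k(3) by (auto simp: DC_ind_def convergent_def dest: limI)
qed

end
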